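(* Let $d\ge1$, let $\mathcal{T}_h$ be a simplicial mesh of the bounded domain $\Omega\subset\mathbb{R}^d$, let $\mathcal{T}_{\text{FD}}$ be a uniform grid with spacing $h_{\text{FD}}$ overlaying it, and let $I_h^{\text{FD}}$ be the transfer matrix associated with piecewise linear interpolation, with column sums $D_{h,j}$ and $D_h=\mathrm{diag}(D_{h,1},\dots,D_{h,N_v})$. Let $h$ be the maximum element diameter of $\mathcal{T}_h$ and $a_h$ the minimum element height of $\mathcal{T}_h$. If $$h_{\text{FD}}\le \frac{a_h}{(d+1)\sqrt d},$$ then the following hold. (i) For all $j=1,\dots,N_v$, $$\frac{1}{(d+1)\sqrt d}\cdot\frac{a_h}{h}\le D_{h,j}\le N_{val}\,N_{\text{FD}}^h ,$$ and thus $D_h$ is invertible. (ii) The minimum eigenvalue of $(I_h^{\text{FD}})^T I_h^{\text{FD}}$ is bounded below by $$\lambda_{min}\big((I_h^{\text{FD}})^T I_h^{\text{FD}}\big)\ge C\left(\frac{a_h}{h}\right)^{2d},$$ where $C$ is a positive constant (independent of the mesh $\mathcal{T}_h$ and the grid $\mathcal{T}_{\text{FD}}$). (iii) $I_h^{\text{FD}}$ has full column rank.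
   Context: Setting: $\Omega\subset\mathbb{R}^d$ is a bounded domain and $\mathcal{T}_h$ is a (finite, conforming) simplicial mesh fitting $\Omega$, i.e. the union of its closed, nondegenerate simplicial elements is $\bar\Omega$; it is not necessarily quasi-uniform. Its vertices are $x_1,\dots,x_{N_v}$. The cube $(-R,R)^d$ covers $\Omega$ and $\mathcal{T}_h$. For a positive integer $N$, $h_{\text{FD}}=R/N$, and $\mathcal{T}_{\text{FD}}$ is the uniform grid of the $N_v^{\text{FD}}=(2N+1)^d$ nodes $h_{\text{FD}}\,j$, $j\in\{-N,\dots,N\}^d$, denoted $x_k^{\text{FD}}$, $k=1,\dots,N_v^{\text{FD}}$. Transfer matrix: let $\phi_j$ be the continuous piecewise linear Lagrange basis function on $\mathcal{T}_h$ associated with the vertex $x_j$ (linear on each element, $\phi_j(x_i)=\delta_{ij}$), set to zero outside $\bar\Omega$. Then $I_h^{\text{FD}}$ is the $N_v^{\text{FD}}\times N_v$ matrix with $(I_h^{\text{FD}})_{k,j}=\phi_j(x_k^{\text{FD}})$, and $D_{h,j}=\sum_{k=1}^{N_v^{\text{FD}}}(I_h^{\text{FD}})_{k,j}$. Heights: for a simplex $K$ with vertices $x_0^K,\dots,x_d^K$, the height $a_j$ is the distance from $x_j^K$ to the facet $S_j$ formed by all the other vertices (equivalently to the hyperplane containing it); $a_K=\min_j a_j$ and $a_h=\min_{K\in\mathcal{T}_h}a_K$. Counting quantities: $\omega_j$ is the patch of elements having $x_j$ as a vertex, $N_{val}=\max_j \#\omega_j$ is the maximal number of elements in a patch, and $N_{\text{FD}}^h=\max_{K\in\mathcal{T}_h}\#\{k: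 x_k^{\text{FD}}\in\bar K\}$. *)

theory Defs
  imports "HOL-Analysis.Analysis" "Jordan_Normal_Form.Spectral_Radius" "Jordan_Normal_Form.DL_Rank"
begin

text \<open>
  \<open>\<real>\<^sup>d\<close> is a type of class \<^class>\<open>euclidean_space\<close>, with \<open>d = DIM('a)\<close>.  The transfer matrix has
  mesh-dependent dimensions, so it is a matrix with explicit dimensions, with rows and columns
  counted from 0.
\<close>

subsection \<open>The mesh\<close>

text \<open>
  The elements are closed.  \<^const>\<open>triangulation\<close> supplies finiteness and conformity: any two
  elements meet in a common, possibly empty, face.
\<close>

definition simplicial_mesh :: "'a::euclidean_space set \<Rightarrow> 'a set set \<Rightarrow> bool" where
  "simplicial_mesh Omega T \<longleftrightarrow>
     triangulation T \<and> (\<forall>K\<in>T. int DIM('a) simplex K) \<and> \<Union>T = closure Omega"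

definition vertices :: "'a::euclidean_space set \<Rightarrow> 'a set" where
  "vertices K = {v. v extreme_point_of K}"

definition mesh_vertices :: "'a::euclidean_space set set \<Rightarrow> 'a set" where
  "mesh_vertices T = (\<Union>K\<in>T. vertices K)"

text \<open>
  Heights are perpendicular heights: the distance to the hyperplane through the opposite facet.
  The distance to the facet itself is larger if the foot of the perpendicular lies outside it.
\<close>

definition height :: "'a::euclidean_space set \<Rightarrow> 'a \<Rightarrow> real" where
  "height K v = infdist v (affine hull (vertices K - {v}))"

definition min_height :: "'a::euclidean_space set \<Rightarrow> real" where
  "min_height K = Min (height K ` vertices K)"

definition mesh_min_height :: "'a::euclidean_space set set \<Rightarrow> real" where
  "mesh_min_height T = Min (min_height ` T)"

definition mesh_size :: "'a::euclidean_space set set \<Rightarrow> real" where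
  "mesh_size T = Max (diameter ` T)"

definition patch :: "'a::euclidean_space set set \<Rightarrow> 'a \<Rightarrow> 'a set set" where
  "patch T v = {K \<in> T. v \<in> vertices K}"

definition max_patch_card :: "'a::euclidean_space set set \<Rightarrow> nat" where
  "max_patch_card T = Max ((\<lambda>v. card (patch T v)) ` mesh_vertices T)"

definition is_lagrange_basis ::
    "'a::euclidean_space set set \<Rightarrow> 'a \<Rightarrow> ('a \<Rightarrow> real) \<Rightarrow> bool" where
  "is_lagrange_basis T v f \<longleftrightarrow>
     continuous_on (\<Union>T) f \<and>
     (\<forall>K\<in>T. \<exists>a b. \<forall>x\<in>K. f x = a \<bullet> x + b) \<and>
     (\<forall>w\<in>mesh_vertices T. f w = (if w = v then 1 else 0)) \<and>
     (\<forall>x. x \<notin> \<Union>T \<longrightarrow> f x = 0)"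

text \<open>Well-defined on a mesh, since an affine function on a simplex is fixed by its vertex values.\<close>

definition lagrange_basis :: "'a::euclidean_space set set \<Rightarrow> 'a \<Rightarrow> 'a \<Rightarrow> real" where
  "lagrange_basis T v = (THE f. is_lagrange_basis T v f)"

subsection \<open>The uniform grid\<close>

definition fd_spacing :: "real \<Rightarrow> nat \<Rightarrow> real" where
  "fd_spacing R N = R / real N"

definition fd_grid :: "real \<Rightarrow> nat \<Rightarrow> 'a::euclidean_space set" where
  "fd_grid R N =
     {x. \<forall>b\<in>Basis. \<exists>j\<in>{- int N..int N}. x \<bullet> b = fd_spacing R N * of_int j}"

definition max_grid_card :: "'a::euclidean_space set set \<Rightarrow> real \<Rightarrow> nat \<Rightarrow> nat" where
  "max_grid_card T R N = Max ((\<lambda>K. card (fd_grid R N \<inter> K)) ` T)"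

subsection \<open>The transfer matrix\<close>

text \<open>
  The lists \<open>vs\<close> and \<open>gs\<close> enumerate the mesh vertices and the grid nodes.
\<close>

definition transfer_mat ::
    "'a::euclidean_space set set \<Rightarrow> 'a list \<Rightarrow> 'a list \<Rightarrow> real mat" where
  "transfer_mat T vs gs =
     Matrix.mat (length gs) (length vs) (\<lambda>(k, j). lagrange_basis T (vs ! j) (gs ! k))"

definition col_sum :: "real mat \<Rightarrow> nat \<Rightarrow> real" where
  "col_sum A j = (\<Sum>k<dim_row A. A $$ (k, j))"

text \<open>Only meant for symmetric matrices, all of whose eigenvalues are real.\<close>

definition min_eigenvalue :: "real mat \<Rightarrow> real" where
  "min_eigenvalue A = Min (spectrum A)"

definition full_column_rank :: "real mat \<Rightarrow> bool" where
  "full_column_rank A \<longleftrightarrow> vec_space.rank (dim_row A) A = dim_col A"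

end

theory Submission
  imports Defs
begin

text \<open>
  Let \<open>d\<close> be the dimension, \<open>a\<close> the smallest element height and \<open>h\<close> the mesh size.  In an element
  \<open>K\<close>, all barycentric coordinates equal \<open>1 / (d + 1)\<close> at the barycentre, and the gradient of each
  has length one over the corresponding height.  So \<open>K\<close> contains the closed ball of radius
  \<open>a / (d + 1)\<close> around its barycentre (lemma \<open>cball_barycentre_subset\<close>).  The hypothesis on the grid
  spacing says that this radius is at least the diameter of a grid cell; hence a grid cell that
  contains the barycentre lies in \<open>K\<close>.

  \<^bold>\<open>Column sums.\<close>  The basis function of a vertex of \<open>K\<close> is affine on \<open>K\<close> with value \<open>1 / (d + 1)\<close> at
  the barycentre.  Rounding the barycentre to a corner of its grid cell, each coordinate in the
  direction in which the function grows, produces a grid node of \<open>K\<close> at which the value is at least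
  \<open>1 / (d + 1)\<close>.  Since the basis functions are nonnegative and \<open>a \<le> h\<close>, this gives the lower bound.
  The upper bound counts the grid nodes in the patch of the vertex, where the function is at most \<open>1\<close>.

  \<^bold>\<open>Smallest eigenvalue.\<close>  It suffices to bound the Euclidean norm of the nodal values of a finite
  element function by that of its values on the grid, because the spectrum of the Gram matrix is a
  nonempty set of Rayleigh quotients.  Fix a multiple \<open>H\<close> of the grid spacing which lies
  between \<open>a / (2 (d + 1) sqrt d)\<close> and \<open>a / ((d + 1) sqrt d)\<close>.  For each \<open>K\<close> take the stencil that consists
  of the barycentre rounded down to multiples of \<open>H\<close> and its \<open>d\<close> forward neighbours at distance
  \<open>H\<close>.  These are grid nodes in \<open>K\<close>, and the \<open>d + 1\<close> values of an affine function there determine its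
  gradient.  So they bound the values at the vertices of \<open>K\<close>, up to a factor which is a constant
  times \<open>h / a\<close> (lemma \<open>affine_fun_bound_from_stencil\<close>).

  When these bounds are summed over the elements, a grid node on many element boundaries might be
  used many times, with a multiplicity that the dimension does not control.  This does not happen:
  since the rounding is half-open, a stencil node of \<open>K\<close> enters the interior of \<open>K\<close> when it is pushed
  slightly in the direction \<open>- One\<close>, which is the same direction for all elements.  As interiors are
  disjoint, stencils of distinct elements are disjoint (lemma \<open>stencils_disjoint\<close>).  The outcome is the
  lower bound \<open>C (a / h)\<^sup>2\<close>, which implies the asserted one because \<open>a \<le> h\<close>.  As the bound is
  positive, the transfer matrix is injective and has full column rank.
\<close>

section \<open>Affine functions on simplices\<close>

lemma affine_fun_eq_on_convex_hull:
  fixes a a' :: "'a::real_inner"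
  assumes "\<And>v. v \<in> C \<Longrightarrow> inner a v + b = inner a' v + b'" and "x \<in> convex hull C"
  shows "inner a x + b = inner a' x + b'"
proof -
  have eq: "{x. inner a x + b = inner a' x + b'} = {x. inner (a - a') x = b' - b}"
    by (auto simp: inner_diff_left)
  have "convex {x. inner a x + b = inner a' x + b'}"
    unfolding eq by (rule convex_hyperplane)
  then have "convex hull C \<subseteq> {x. inner a x + b = inner a' x + b'}"
    using assms(1) by (intro hull_minimal) auto
  then show ?thesis using assms(2) by auto
qed

lemma affine_fun_ge_on_convex_hull:
  fixes a :: "'a::real_inner"
  assumes "\<And>v. v \<in> C \<Longrightarrow> l \<le> inner a v + b" and "x \<in> convex hull C"
  shows "l \<le> inner a x + b"
proof -
  have eq: "{x. l \<le> inner a x + b} = {x. inner a x \<ge> l - b}"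
    by auto
  have "convex {x. l \<le> inner a x + b}"
    unfolding eq by (rule convex_halfspace_ge)
  then have "convex hull C \<subseteq> {x. l \<le> inner a x + b}"
    using assms(1) by (intro hull_minimal) auto
  then show ?thesis using assms(2) by auto
qed

lemma affine_fun_le_on_convex_hull:
  fixes a :: "'a::real_inner"
  assumes "\<And>v. v \<in> C \<Longrightarrow> inner a v + b \<le> l" and "x \<in> convex hull C"
  shows "inner a x + b \<le> l"
  using affine_fun_ge_on_convex_hull[of C "- l" "- a" "- b" x] assms by force

lemma affine_fun_affine_combination:
  fixes a :: "'a::real_inner"
  assumes "sum w C = 1"
  shows "inner a (\<Sum>v\<in>C. w v *\<^sub>R v) + b = (\<Sum>v\<in>C. w v * (inner a v + b))"
proof -
  have "(\<Sum>v\<in>C. w v * (inner a v + b)) = (\<Sum>v\<in>C. w v * inner a v) + sum w C * b"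
    by (simp add: distrib_left sum.distrib sum_distrib_right)
  then show ?thesis by (simp add: assms inner_sum_right)
qed

text \<open>Affine independence of \<open>C\<close> says that the differences \<open>v - c\<close> to one fixed point \<open>c\<close> of \<open>C\<close> are
  linearly independent, so a linear functional can be prescribed freely on them.\<close>

lemma affine_interpolation:
  fixes u :: "'a::euclidean_space \<Rightarrow> real"
  assumes "\<not> affine_dependent C"
  shows "\<exists>a b. \<forall>v\<in>C. inner a v + b = u v"
proof (cases "C = {}")
  case False
  then obtain c where c: "c \<in> C" by auto
  have ind: "independent ((\<lambda>x. - c + x) ` (C - {c}))"
    using assms affine_dependent_iff_dependent2[OF c] by blast
  obtain g where g: "linear g"
      and gv: "\<forall>x\<in>(\<lambda>x. - c + x) ` (C - {c}). g x = (\<lambda>x. u (c + x) - u c) x"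
    using linear_independent_extend[OF ind, of "\<lambda>x. u (c + x) - u c"] by blast
  define a where "a = adjoint g 1"
  have ga: "g x = inner a x" for x
    unfolding a_def using adjoint_works[OF g, of x 1] by (simp add: inner_commute)
  have "inner a v + (u c - inner a c) = u v" if "v \<in> C" for v
  proof (cases "v = c")
    case False
    then have "g (- c + v) = u (c + (- c + v)) - u c" using gv that by blast
    then have "inner a (- c + v) = u v - u c" by (simp add: ga)
    then show ?thesis by (simp add: inner_diff_right inner_add_right)
  qed simp
  then show ?thesis by blast
qed simp

lemma simplex_vertices:
  fixes K :: "'a::euclidean_space set"
  assumes "int n simplex K"
  shows "\<not> affine_dependent (vertices K)" "finite (vertices K)" "card (vertices K) = n + 1"
    "K = convex hull (vertices K)"
proof -
  obtain C where C: "\<not> affine_dependent C" "int (card C) = int n + 1" "K = convex hull C"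
    using assms unfolding simplex_def by auto
  have "vertices K = C"
    unfolding vertices_def C(3) using extreme_point_of_convex_hull_affine_independent[OF C(1)] by auto
  then show "\<not> affine_dependent (vertices K)" "finite (vertices K)" "card (vertices K) = n + 1"
      "K = convex hull (vertices K)"
    using C aff_independent_finite by auto
qed

lemma vertices_subset: "vertices K \<subseteq> K"
  by (auto simp: vertices_def extreme_point_of_def)

text \<open>Dividing by the height turns a distance into a change of barycentric coordinate: the
  coordinate of \<open>v\<close> is an affine function which vanishes on the opposite facet, so its
  gradient has length one over the height.\<close>

lemma barycentric_gradient_bound:
  fixes K :: "'a::euclidean_space set"
  assumes K: "int DIM('a) simplex K" and v: "v \<in> vertices K"
    and g: "\<And>w. w \<in> vertices K \<Longrightarrow> inner a w + b = (if w = v then 1 else 0)"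
  shows "norm a * height K v \<le> 1"
proof (cases "a = 0")
  case False
  note sv = simplex_vertices[OF K]
  \<comment> \<open>The foot of the perpendicular from \<open>v\<close> to the hyperplane on which the coordinate vanishes.\<close>
  define z where "z = v - (1 / (norm a)\<^sup>2) *\<^sub>R a"
  have z0: "inner a z + b = 0"
    using g[OF v] False by (simp add: z_def inner_diff_right power2_norm_eq_inner)
  have "affine hull (vertices K) = UNIV"
    using sv by (intro affine_independent_span_eq) auto
  then have "z \<in> affine hull (vertices K)" by simp
  then obtain w where w: "sum w (vertices K) = 1" "(\<Sum>x\<in>vertices K. w x *\<^sub>R x) = z"
    unfolding affine_hull_finite[OF sv(2)] by auto
  have "0 = (\<Sum>x\<in>vertices K. w x * (inner a x + b))"
    using affine_fun_affine_combination[OF w(1), of a b] z0 w(2) by simp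
  also have "\<dots> = (\<Sum>x\<in>vertices K. if x = v then w x else 0)"
    by (rule sum.cong) (auto simp: g)
  also have "\<dots> = w v" using v sv(2) by simp
  finally have wv: "w v = 0" by simp
  have "sum w (vertices K - {v}) = 1" "(\<Sum>x\<in>vertices K - {v}. w x *\<^sub>R x) = z"
    using w wv v sv(2) by (simp_all add: sum.remove)
  then have "z \<in> affine hull (vertices K - {v})"
    using sv(2) by (subst affine_hull_finite) auto
  then have "height K v \<le> dist v z"
    unfolding height_def by (rule infdist_le)
  also have "dist v z = 1 / norm a"
    using False by (simp add: z_def dist_norm power2_eq_square)
  finally show ?thesis using False by (simp add: field_simps)
qed simp

definition barycentre :: "'a::euclidean_space set \<Rightarrow> 'a" where
  "barycentre K = (\<Sum>v\<in>vertices K. (1 / (real DIM('a) + 1)) *\<^sub>R v)"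

lemma affine_fun_barycentre:
  fixes K :: "'a::euclidean_space set"
  assumes K: "int DIM('a) simplex K"
  shows "inner a (barycentre K) + b
    = (\<Sum>v\<in>vertices K. inner a v + b) / (real DIM('a) + 1)"
proof -
  have "(\<Sum>v\<in>vertices K. 1 / (real DIM('a) + 1)) = 1"
    using simplex_vertices(3)[OF K] by (simp add: add.commute)
  from affine_fun_affine_combination[OF this, of a b] show ?thesis
    unfolding barycentre_def sum_divide_distrib by (simp only: times_divide_eq_left mult_1_left)
qed

lemma min_height_le:
  assumes "int n simplex K" "v \<in> vertices K"
  shows "min_height K \<le> height K v"
  using assms simplex_vertices(2)[OF assms(1)] by (simp add: min_height_def)

text \<open>At the barycentre every barycentric coordinate equals \<open>1 / (d + 1)\<close>, and moving by at most
  \<open>min_height K / (d + 1)\<close> changes each of them by at most that much.\<close>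

lemma cball_barycentre_subset:
  fixes K :: "'a::euclidean_space set"
  assumes K: "int DIM('a) simplex K"
  shows "cball (barycentre K) (min_height K / (real DIM('a) + 1)) \<subseteq> K"
proof
  fix x assume x: "x \<in> cball (barycentre K) (min_height K / (real DIM('a) + 1))"
  note sv = simplex_vertices[OF K]
  let ?c = "barycentre K" and ?d = "real DIM('a) + 1"
  have "affine hull (vertices K) = UNIV"
    using sv by (intro affine_independent_span_eq) auto
  then have "x \<in> affine hull (vertices K)" by simp
  then obtain w where w: "sum w (vertices K) = 1" "(\<Sum>x\<in>vertices K. w x *\<^sub>R x) = x"
    unfolding affine_hull_finite[OF sv(2)] by auto
  have "0 \<le> w v" if v: "v \<in> vertices K" for v
  proof -
    obtain a b where ab: "\<forall>y\<in>vertices K. inner a y + b = (if y = v then 1 else 0::real)"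
      using affine_interpolation[OF sv(1), of "\<lambda>y. if y = v then 1 else 0"] by blast
    have "inner a x + b = (\<Sum>y\<in>vertices K. w y * (inner a y + b))"
      using affine_fun_affine_combination[OF w(1), of a b] w(2) by simp
    also have "\<dots> = (\<Sum>y\<in>vertices K. if y = v then w y else 0)"
      by (rule sum.cong) (auto simp: ab)
    also have "\<dots> = w v" using v sv(2) by simp
    finally have 1: "w v = inner a x + b" by simp
    have "inner a ?c + b = (\<Sum>y\<in>vertices K. if y = v then 1 else 0) / ?d"
      unfolding affine_fun_barycentre[OF K] using ab by simp
    then have 2: "inner a ?c + b = 1 / ?d" using v sv(2) by simp
    have "inner a ?c - inner a x = inner a (?c - x)" by (simp add: inner_diff_right)
    also have "\<dots> \<le> norm a * dist ?c x" by (simp add: dist_norm norm_cauchy_schwarz)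
    also have "\<dots> \<le> norm a * (min_height K / ?d)"
      using x by (intro mult_left_mono) auto
    also have "\<dots> \<le> norm a * (height K v / ?d)"
      using min_height_le[OF K v] by (intro mult_left_mono divide_right_mono) auto
    also have "\<dots> \<le> 1 / ?d"
      using barycentric_gradient_bound[OF K v, of a b] ab by (simp add: divide_right_mono)
    finally show ?thesis using 1 2 by simp
  qed
  then have "\<exists>u. (\<forall>x\<in>vertices K. 0 \<le> u x) \<and> sum u (vertices K) = 1 \<and>
      (\<Sum>x\<in>vertices K. u x *\<^sub>R x) = x"
    using w by blast
  then show "x \<in> K"
    by (subst sv(4), subst convex_hull_finite[OF sv(2)]) simp
qed

section \<open>The Lagrange basis\<close>

context
  fixes T :: "'a::euclidean_space set set" and Omega :: "'a set"
  assumes mesh: "simplicial_mesh Omega T"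
begin

lemma mesh_finite: "finite T"
  and mesh_simplex: "K \<in> T \<Longrightarrow> int DIM('a) simplex K"
  and mesh_face: "K \<in> T \<Longrightarrow> L \<in> T \<Longrightarrow> (K \<inter> L) face_of K"
  and mesh_Union: "\<Union>T = closure Omega"
  using mesh by (auto simp: simplicial_mesh_def triangulation_def)

lemma finite_mesh_vertices: "finite (mesh_vertices T)"
  unfolding mesh_vertices_def using mesh_finite simplex_vertices(2)[OF mesh_simplex] by blast

lemma mesh_compact: "K \<in> T \<Longrightarrow> compact K"
  using simplex_vertices(2,4)[OF mesh_simplex] finite_imp_compact_convex_hull by metis

text \<open>By Krein--Milman the common face is the convex hull of its extreme points, and an extreme point
  of a face is an extreme point of either element.\<close>

lemma mesh_intersection_hull:
  assumes K: "K \<in> T" and L: "L \<in> T"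
  shows "K \<inter> L \<subseteq> convex hull (vertices K \<inter> vertices L)"
proof -
  have "compact (K \<inter> L)" using mesh_compact K L by (simp add: compact_Int compact_imp_closed)
  moreover have "convex (K \<inter> L)"
    using simplex_vertices(4)[OF mesh_simplex] K L by (metis convex_Int convex_convex_hull)
  ultimately have "K \<inter> L = convex hull {x. x extreme_point_of (K \<inter> L)}"
    by (rule Krein_Milman_Minkowski)
  moreover have "{x. x extreme_point_of (K \<inter> L)} \<subseteq> vertices K \<inter> vertices L"
    using extreme_point_of_face[OF mesh_face[OF K L]] extreme_point_of_face[OF mesh_face[OF L K]]
    by (auto simp: vertices_def Int_commute)
  ultimately show ?thesis using hull_mono by metis
qed

text \<open>The intersection of two elements is a face of both, and a face that meets the interior of a
  convex set is the whole set.\<close>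

lemma mesh_interior_disjoint:
  assumes K: "K \<in> T" and L: "L \<in> T" and x: "x \<in> interior K" "x \<in> interior L"
  shows "K = L"
proof -
  have *: "K \<subseteq> K \<inter> L" if "K \<in> T" "L \<in> T" "x \<in> interior K" "x \<in> interior L" for K L :: "'a set"
  proof (rule subset_of_face_of[OF mesh_face[OF that(1,2)]])
    show "(K \<inter> L) \<inter> rel_interior K \<noteq> {}"
      using that interior_subset_rel_interior[of K] interior_subset[of K] interior_subset[of L] by blast
  qed simp
  show ?thesis using *[OF K L x] *[OF L K x(2,1)] by blast
qed

text \<open>The affine pieces fit together because neighbouring elements share the vertices of their
  common face, and values at those vertices determine an affine function on the face.\<close>

lemma lagrange_basis_exists: "\<exists>f. is_lagrange_basis T v f"
proof -
  have "\<exists>a b. \<forall>w\<in>vertices K. inner a w + b = (if w = v then 1 else 0::real)" if "K \<in> T" for K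
    using affine_interpolation[OF simplex_vertices(1)[OF mesh_simplex[OF that]],
        of "\<lambda>w. if w = v then 1 else 0"] .
  then obtain a b where ab:
    "\<And>K w. K \<in> T \<Longrightarrow> w \<in> vertices K \<Longrightarrow> inner (a K) w + b K = (if w = v then 1 else 0::real)"
    by metis
  define f where "f x = (if x \<in> \<Union>T then
      let K = SOME K. K \<in> T \<and> x \<in> K in inner (a K) x + b K else 0)" for x
  have fK: "f x = inner (a K) x + b K" if K: "K \<in> T" and x: "x \<in> K" for K x
  proof -
    define L where "L = (SOME K. K \<in> T \<and> x \<in> K)"
    have L: "L \<in> T \<and> x \<in> L" unfolding L_def by (rule someI[of _ K]) (use K x in blast)
    have "inner (a L) x + b L = inner (a K) x + b K"
    proof (rule affine_fun_eq_on_convex_hull)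
      show "x \<in> convex hull (vertices K \<inter> vertices L)"
        using mesh_intersection_hull[OF K, of L] L x by blast
    qed (use ab K L in auto)
    then show ?thesis using K x unfolding f_def L_def[symmetric] by auto
  qed
  have "continuous_on (\<Union>K\<in>T. K) f"
  proof (rule continuous_on_closed_Union[OF mesh_finite])
    show "closed K" if "K \<in> T" for K using mesh_compact[OF that] by (rule compact_imp_closed)
    show "continuous_on K f" if "K \<in> T" for K
      by (rule continuous_on_eq[of _ "\<lambda>x. inner (a K) x + b K"])
        (use fK that in \<open>auto intro!: continuous_intros\<close>)
  qed
  moreover have "f w = (if w = v then 1 else 0)" if "w \<in> mesh_vertices T" for w
  proof -
    obtain K where "K \<in> T" "w \<in> vertices K" using \<open>w \<in> mesh_vertices T\<close> by (auto simp: mesh_vertices_def)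
    then show ?thesis using fK[of K w] ab[of K w] vertices_subset[of K] by auto
  qed
  ultimately have "is_lagrange_basis T v f"
    unfolding is_lagrange_basis_def using fK by (auto simp: f_def)
  then show ?thesis by blast
qed

lemma lagrange_basis_unique:
  assumes "is_lagrange_basis T v f" "is_lagrange_basis T v g"
  shows "f = g"
proof
  fix x
  show "f x = g x"
  proof (cases "x \<in> \<Union>T")
    case True
    then obtain K where K: "K \<in> T" "x \<in> K" by auto
    obtain a b where f: "\<forall>x\<in>K. f x = inner a x + b"
      using assms(1) K unfolding is_lagrange_basis_def by blast
    obtain a' b' where g: "\<forall>x\<in>K. g x = inner a' x + b'"
      using assms(2) K unfolding is_lagrange_basis_def by blast
    have "inner a x + b = inner a' x + b'"
    proof (rule affine_fun_eq_on_convex_hull)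
      show "x \<in> convex hull (vertices K)" using simplex_vertices(4)[OF mesh_simplex] K by blast
      fix w assume w: "w \<in> vertices K"
      then have "w \<in> mesh_vertices T" using K by (auto simp: mesh_vertices_def)
      then have "f w = g w" using assms by (simp add: is_lagrange_basis_def)
      then show "inner a w + b = inner a' w + b'" using f g w vertices_subset by (metis subsetD)
    qed
    then show ?thesis using f g K by simp
  qed (use assms in \<open>simp add: is_lagrange_basis_def\<close>)
qed

lemma lagrange_basis: "is_lagrange_basis T v (lagrange_basis T v)"
  unfolding lagrange_basis_def
  using lagrange_basis_exists lagrange_basis_unique by (metis theI)

lemma lagrange_basis_affine:
  assumes "K \<in> T"
  obtains a b where "\<And>x. x \<in> K \<Longrightarrow> lagrange_basis T v x = inner a x + b"
    "\<And>w. w \<in> vertices K \<Longrightarrow> inner a w + b = (if w = v then 1 else 0)"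
proof -
  obtain a b where ab: "\<forall>x\<in>K. lagrange_basis T v x = inner a x + b"
    using lagrange_basis[of v] assms unfolding is_lagrange_basis_def by blast
  have "inner a w + b = (if w = v then 1 else 0)" if "w \<in> vertices K" for w
  proof -
    have "w \<in> mesh_vertices T" "w \<in> K"
      using that assms vertices_subset by (auto simp: mesh_vertices_def)
    then show ?thesis using lagrange_basis[of v] ab by (metis is_lagrange_basis_def)
  qed
  then show thesis using that ab by blast
qed

lemma lagrange_basis_bounds: "0 \<le> lagrange_basis T v x" "lagrange_basis T v x \<le> 1"
proof -
  have "0 \<le> lagrange_basis T v x \<and> lagrange_basis T v x \<le> 1"
  proof (cases "x \<in> \<Union>T")
    case True
    then obtain K where K: "K \<in> T" "x \<in> K" by auto
    obtain a b where ab: "\<And>x. x \<in> K \<Longrightarrow> lagrange_basis T v x = inner a x + b"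
      "\<And>w. w \<in> vertices K \<Longrightarrow> inner a w + b = (if w = v then 1 else 0)"
      using lagrange_basis_affine[OF K(1)] by blast
    have x: "x \<in> convex hull (vertices K)" using simplex_vertices(4)[OF mesh_simplex] K by blast
    have "0 \<le> inner a x + b" by (rule affine_fun_ge_on_convex_hull[OF _ x]) (simp add: ab(2))
    moreover have "inner a x + b \<le> 1" by (rule affine_fun_le_on_convex_hull[OF _ x]) (simp add: ab(2))
    ultimately show ?thesis using ab K by simp
  qed (use lagrange_basis[of v] in \<open>simp add: is_lagrange_basis_def\<close>)
  then show "0 \<le> lagrange_basis T v x" "lagrange_basis T v x \<le> 1" by auto
qed

text \<open>An affine function that vanishes at all vertices of an element vanishes on the element.\<close>

lemma lagrange_basis_support:
  assumes "lagrange_basis T v x \<noteq> 0"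
  obtains K where "K \<in> patch T v" "x \<in> K"
proof -
  have "x \<in> \<Union>T" using assms lagrange_basis[of v] by (auto simp: is_lagrange_basis_def)
  then obtain K where K: "K \<in> T" "x \<in> K" by auto
  obtain a b where ab: "\<And>x. x \<in> K \<Longrightarrow> lagrange_basis T v x = inner a x + b"
    "\<And>w. w \<in> vertices K \<Longrightarrow> inner a w + b = (if w = v then 1 else 0)"
    using lagrange_basis_affine[OF K(1)] by blast
  have x: "x \<in> convex hull (vertices K)" using simplex_vertices(4)[OF mesh_simplex] K by blast
  have "v \<in> vertices K"
  proof (rule ccontr)
    assume "v \<notin> vertices K"
    then have "inner a x + b = inner 0 x + 0"
      by (intro affine_fun_eq_on_convex_hull[OF _ x]) (use ab(2) in auto)
    then show False using ab K assms by simp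
  qed
  then show thesis using K that by (auto simp: patch_def)
qed

end

section \<open>Grid stencils\<close>

lemma norm_less_coordinatewise:
  fixes x :: "'a::euclidean_space"
  assumes "\<And>b. b \<in> Basis \<Longrightarrow> \<bar>inner x b\<bar> < r"
  shows "norm x < sqrt (real DIM('a)) * r"
proof -
  have "infnorm x < r" using assms by (simp add: infnorm_Max)
  then have "sqrt (real DIM('a)) * infnorm x < sqrt (real DIM('a)) * r" by simp
  then show ?thesis using norm_le_infnorm[of x] by linarith
qed

lemma norm_le_coordinatewise:
  fixes x :: "'a::euclidean_space"
  assumes "\<And>b. b \<in> Basis \<Longrightarrow> \<bar>inner x b\<bar> \<le> r"
  shows "norm x \<le> sqrt (real DIM('a)) * r"
proof -
  have "infnorm x \<le> r" using assms by (simp add: infnorm_Max)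
  then have "sqrt (real DIM('a)) * infnorm x \<le> sqrt (real DIM('a)) * r"
    by (simp add: mult_left_mono)
  then show ?thesis using norm_le_infnorm[of x] by linarith
qed

definition grid_floor :: "real \<Rightarrow> 'a::euclidean_space \<Rightarrow> 'a" where
  "grid_floor H c = (\<Sum>b\<in>Basis. (H * of_int \<lfloor>inner c b / H\<rfloor>) *\<^sub>R b)"

definition stencil :: "real \<Rightarrow> 'a::euclidean_space \<Rightarrow> 'a set" where
  "stencil H c = insert (grid_floor H c) ((\<lambda>b. grid_floor H c + H *\<^sub>R b) ` Basis)"

lemma finite_stencil: "finite (stencil H c)"
  by (simp add: stencil_def)

lemma grid_floor_inner:
  "b \<in> Basis \<Longrightarrow> inner (grid_floor H c) b = H * of_int \<lfloor>inner c b / H\<rfloor>"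
  by (simp add: grid_floor_def)

lemma grid_floor_bounds:
  assumes "0 < H" "b \<in> Basis"
  shows "inner (grid_floor H c) b \<le> inner c b" "inner c b < inner (grid_floor H c) b + H"
  using floor_divide_lower[OF assms(1), of "inner c b"] floor_divide_upper[OF assms(1), of "inner c b"]
  by (simp_all add: grid_floor_inner assms(2) algebra_simps)

lemma stencil_inner:
  assumes "y \<in> stencil H c" "b \<in> Basis"
  obtains j :: int where "inner y b = H * of_int j" "j = \<lfloor>inner c b / H\<rfloor> \<or> j = \<lfloor>inner c b / H\<rfloor> + 1"
proof -
  have "inner y b = H * of_int \<lfloor>inner c b / H\<rfloor> \<or> inner y b = H * of_int (\<lfloor>inner c b / H\<rfloor> + 1)"
    using assms by (auto simp: stencil_def grid_floor_inner inner_add_left inner_Basis distrib_left)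
  then show thesis using that by blast
qed

lemma stencil_coordinate_bounds:
  fixes c :: "'a::euclidean_space"
  assumes H: "0 < H" and y: "y \<in> stencil H c" and b: "b \<in> Basis"
  shows "- H < inner (y - c) b \<and> inner (y - c) b \<le> H"
proof -
  obtain j where "inner y b = H * of_int j" "j = \<lfloor>inner c b / H\<rfloor> \<or> j = \<lfloor>inner c b / H\<rfloor> + 1"
    using stencil_inner[OF y b] by blast
  then have "inner y b = inner (grid_floor H c) b \<or> inner y b = inner (grid_floor H c) b + H"
    using b by (auto simp: grid_floor_inner distrib_left)
  then show ?thesis
    using grid_floor_bounds[OF H b, of c] H by (auto simp: inner_diff_left)
qed

text \<open>Relative to \<open>c\<close> the coordinates of a stencil node lie in the half-open interval from \<open>-H\<close>
  (excluded) to \<open>H\<close>, so pushing the node slightly in the direction \<open>- One\<close> makes all of them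
  smaller than \<open>H\<close> in absolute value.\<close>

lemma stencil_pushed_into_ball:
  fixes c :: "'a::euclidean_space"
  assumes H: "0 < H" "sqrt (real DIM('a)) * H \<le> r" and y: "y \<in> stencil H c"
  shows "\<exists>s>0. \<forall>t. 0 < t \<and> t < s \<longrightarrow> y - t *\<^sub>R One \<in> ball c r"
proof -
  note yb = stencil_coordinate_bounds[OF H(1) y]
  define s where "s = Min ((\<lambda>b. H + inner (y - c) b) ` Basis)"
  have "0 < s" unfolding s_def using yb by (subst Min_gr_iff) force+
  moreover have "y - t *\<^sub>R One \<in> ball c r" if t: "0 < t" "t < s" for t
  proof -
    have "norm (y - t *\<^sub>R One - c) < sqrt (real DIM('a)) * H"
    proof (rule norm_less_coordinatewise)
      fix b :: 'a assume b: "b \<in> Basis"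
      have "s \<le> H + inner (y - c) b" unfolding s_def using b by (intro Min_le) auto
      then show "\<bar>inner (y - t *\<^sub>R One - c) b\<bar> < H"
        using yb[OF b] t b by (simp add: inner_diff_left abs_less_iff)
    qed
    then show ?thesis using H(2) by (simp add: dist_norm norm_minus_commute)
  qed
  ultimately show ?thesis by blast
qed

text \<open>An affine function is determined by its values at a grid node and at the \<open>d\<close> neighbours in
  the coordinate directions: the differences give the gradient.\<close>

lemma affine_fun_bound_from_stencil:
  fixes a c x :: "'a::euclidean_space"
  assumes H: "0 < H" and M: "\<And>y. y \<in> stencil H c \<Longrightarrow> \<bar>inner a y + b\<bar> \<le> M"
    and x: "dist (grid_floor H c) x \<le> D"
  shows "\<bar>inner a x + b\<bar> \<le> M * (1 + 2 * real DIM('a) * D / H)"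
proof -
  let ?y = "grid_floor H c"
  have y: "\<bar>inner a ?y + b\<bar> \<le> M" by (rule M) (simp add: stencil_def)
  then have M0: "0 \<le> M" by linarith
  have D0: "0 \<le> D" using x zero_le_dist[of ?y x] by linarith
  have grad: "\<bar>inner a i\<bar> \<le> 2 * M / H" if i: "i \<in> Basis" for i
  proof -
    have "\<bar>inner a (?y + H *\<^sub>R i) + b\<bar> \<le> M" by (rule M) (use i in \<open>auto simp: stencil_def\<close>)
    then have "\<bar>H * inner a i\<bar> \<le> 2 * M" using y by (simp add: inner_add_right)
    then show ?thesis using H by (simp add: abs_mult field_simps)
  qed
  have "inner a (x - ?y) = (\<Sum>i\<in>Basis. inner a i * inner (x - ?y) i)"
    by (rule euclidean_inner)
  also have "\<bar>\<dots>\<bar> \<le> (\<Sum>i\<in>(Basis::'a set). 2 * M / H * D)"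
  proof (rule order_trans[OF sum_abs sum_mono])
    fix i :: 'a assume i: "i \<in> Basis"
    have "\<bar>inner (x - ?y) i\<bar> \<le> norm (x - ?y)" using i by (rule Basis_le_norm)
    then have "\<bar>inner (x - ?y) i\<bar> \<le> D" using x by (simp add: dist_norm norm_minus_commute)
    then show "\<bar>inner a i * inner (x - ?y) i\<bar> \<le> 2 * M / H * D"
      unfolding abs_mult using grad[OF i] M0 H by (intro mult_mono) auto
  qed
  finally have "\<bar>inner a (x - ?y)\<bar> \<le> M * (2 * real DIM('a) * D / H)" by (simp add: field_simps)
  then show ?thesis using y by (simp add: inner_diff_right distrib_left)
qed

text \<open>Each coordinate is rounded up or down according to the sign of that of \<open>a\<close>, so that every term
  of the inner product grows.\<close>

lemma affine_fun_grid_rounding: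
  fixes a c :: "'a::euclidean_space"
  assumes H: "0 < H"
  obtains y where "\<And>i. i \<in> Basis \<Longrightarrow> \<exists>j::int. inner y i = H * of_int j"
    "norm (y - c) \<le> sqrt (real DIM('a)) * H" "inner a c \<le> inner a y"
proof -
  define j where "j i = (if inner a i \<le> 0 then \<lfloor>inner c i / H\<rfloor> else \<lceil>inner c i / H\<rceil>)" for i
  define y where "y = (\<Sum>i\<in>Basis. (H * of_int (j i)) *\<^sub>R i)"
  have yi: "inner y i = H * of_int (j i)" if "i \<in> Basis" for i
    using that by (simp add: y_def)
  have fl: "H * of_int \<lfloor>q / H\<rfloor> \<le> q" "q - H * of_int \<lfloor>q / H\<rfloor> \<le> H"
    "q \<le> H * of_int \<lceil>q / H\<rceil>" "H * of_int \<lceil>q / H\<rceil> - q \<le> H" for q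
    using floor_divide_lower[OF H, of q] floor_divide_upper[OF H, of q]
      ceiling_divide_lower[OF H, of q] ceiling_divide_upper[OF H, of q]
    by (simp_all add: algebra_simps)
  have "norm (y - c) \<le> sqrt (real DIM('a)) * H"
  proof (rule norm_le_coordinatewise)
    fix i :: 'a assume "i \<in> Basis"
    then show "\<bar>inner (y - c) i\<bar> \<le> H"
      using fl[of "inner c i"] by (simp add: inner_diff_left yi j_def)
  qed
  moreover have "inner a c \<le> inner a y"
  proof -
    have "inner a c = (\<Sum>i\<in>Basis. inner a i * inner c i)" by (rule euclidean_inner)
    also have "\<dots> \<le> (\<Sum>i\<in>Basis. inner a i * inner y i)"
    proof (rule sum_mono)
      fix i :: 'a assume "i \<in> Basis"
      then show "inner a i * inner c i \<le> inner a i * inner y i"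
        using fl[of "inner c i"] by (auto simp: yi j_def intro: mult_left_mono mult_left_mono_neg)
    qed
    also have "\<dots> = inner a y" by (rule euclidean_inner[symmetric])
    finally show ?thesis .
  qed
  ultimately show thesis using that[of y] yi by blast
qed

lemma fd_grid_memI:
  fixes y :: "'a::euclidean_space"
  assumes "0 < R" "0 < N" "y \<in> box (- R *\<^sub>R One) (R *\<^sub>R One)"
    and "\<And>i. i \<in> Basis \<Longrightarrow> \<exists>j::int. inner y i = fd_spacing R N * of_int j"
  shows "y \<in> fd_grid R N"
  unfolding fd_grid_def
proof (intro CollectI ballI)
  fix i :: 'a assume i: "i \<in> Basis"
  obtain j :: int where j: "inner y i = fd_spacing R N * of_int j" using assms(4)[OF i] by blast
  have "- R < inner y i" "inner y i < R" using assms(3) i by (auto simp: mem_box)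
  then have "R * (- real N) < R * of_int j" "R * of_int j < R * real N"
    using j assms(2) by (simp_all add: fd_spacing_def field_simps)
  then have "- real N < of_int j" "of_int j < real N"
    unfolding mult_less_cancel_left_pos[OF assms(1)] .
  then have "j \<in> {- int N..int N}" by auto
  then show "\<exists>j\<in>{- int N..int N}. inner y i = fd_spacing R N * of_int j" using j by blast
qed

text \<open>Rounding \<open>r\<close> down to a multiple of \<open>\<eta>\<close> loses less than \<open>\<eta>\<close>, which is at most the result.\<close>

lemma coarse_multiple:
  fixes \<eta> r :: real
  assumes "0 < \<eta>" "\<eta> \<le> r"
  obtains m :: nat where "0 < real m * \<eta>" "real m * \<eta> \<le> r" "r \<le> 2 * (real m * \<eta>)"
proof -
  define m where "m = nat \<lfloor>r / \<eta>\<rfloor>"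
  have "1 \<le> r / \<eta>" using assms by simp
  then have "real m = of_int \<lfloor>r / \<eta>\<rfloor>" "1 \<le> real m" unfolding m_def by auto
  then have "1 \<le> real m" "real m \<le> r / \<eta>" "r / \<eta> \<le> 2 * real m"
    by linarith+
  then show thesis using assms that[of m] by (simp add: field_simps)
qed

section \<open>The nodal values are controlled by the grid values\<close>

lemma sum_UNION_le:
  fixes f :: "'b \<Rightarrow> real"
  assumes "finite I" "\<And>i. i \<in> I \<Longrightarrow> finite (A i)" "\<And>x. 0 \<le> f x"
  shows "sum f (\<Union>i\<in>I. A i) \<le> (\<Sum>i\<in>I. sum f (A i))"
  using assms(1,2)
proof (induction I rule: finite_induct)
  case (insert i I)
  have "sum f (A i \<union> (\<Union>i\<in>I. A i)) \<le> sum f (A i) + sum f (\<Union>i\<in>I. A i)"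
    using insert.hyps insert.prems assms(3) by (subst sum_Un) (auto simp: sum_nonneg)
  then show ?case using insert by force
qed simp

context
  fixes T :: "'a::euclidean_space set set" and Omega :: "'a set"
  assumes mesh: "simplicial_mesh Omega T"
begin

text \<open>The finite element function with nodal values \<open>u\<close>: its values at the grid nodes are the
  entries of the transfer matrix applied to \<open>u\<close>.\<close>

lemma nodal_function_affine:
  assumes K: "K \<in> T"
  obtains a b where
    "\<And>x. x \<in> K \<Longrightarrow> (\<Sum>v\<in>mesh_vertices T. u v * lagrange_basis T v x) = inner a x + b"
    "\<And>w. w \<in> vertices K \<Longrightarrow> inner a w + b = u w"
proof -
  let ?V = "mesh_vertices T"
  have "\<exists>a b. (\<forall>x\<in>K. lagrange_basis T v x = inner a x + b) \<and>
      (\<forall>w\<in>vertices K. inner a w + b = (if w = v then 1 else 0))" for v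
    using lagrange_basis_affine[OF mesh K, of v] by metis
  then obtain a b where
    ab: "\<And>v x. x \<in> K \<Longrightarrow> lagrange_basis T v x = inner (a v) x + b v"
      "\<And>v w. w \<in> vertices K \<Longrightarrow> inner (a v) w + b v = (if w = v then 1 else 0)"
    by metis
  define A where "A = (\<Sum>v\<in>?V. u v *\<^sub>R a v)"
  define B where "B = (\<Sum>v\<in>?V. u v * b v)"
  have eq: "inner A x + B = (\<Sum>v\<in>?V. u v * (inner (a v) x + b v))" for x
    by (simp add: A_def B_def inner_sum_left distrib_left sum.distrib)
  have "inner A w + B = u w" if w: "w \<in> vertices K" for w
  proof -
    have "inner A w + B = (\<Sum>v\<in>?V. if w = v then u v else 0)"
      unfolding eq by (rule sum.cong) (auto simp: ab(2)[OF w])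
    moreover have "w \<in> ?V" using w K by (auto simp: mesh_vertices_def)
    ultimately show ?thesis using finite_mesh_vertices[OF mesh] by simp
  qed
  moreover have "(\<Sum>v\<in>?V. u v * lagrange_basis T v x) = inner A x + B" if "x \<in> K" for x
    unfolding eq using ab(1)[OF that] by simp
  ultimately show thesis using that by blast
qed

lemma mesh_min_height_le: "K \<in> T \<Longrightarrow> mesh_min_height T \<le> min_height K"
  unfolding mesh_min_height_def using mesh_finite[OF mesh] by (intro Min_le) auto

lemma diameter_le_mesh_size: "K \<in> T \<Longrightarrow> diameter K \<le> mesh_size T"
  unfolding mesh_size_def using mesh_finite[OF mesh] by (intro Max_ge) auto

lemma dist_le_mesh_size:
  assumes "K \<in> T" "x \<in> K" "y \<in> K"
  shows "dist x y \<le> mesh_size T"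
  using diameter_bounded_bound[OF compact_imp_bounded[OF mesh_compact[OF mesh assms(1)]] assms(2,3)]
    diameter_le_mesh_size[OF assms(1)] by linarith

lemma mesh_min_height_le_mesh_size:
  assumes K: "K \<in> T"
  shows "mesh_min_height T \<le> mesh_size T"
proof -
  note sv = simplex_vertices[OF mesh_simplex[OF mesh K]]
  have "1 < card (vertices K)" using sv(3) DIM_positive[where 'a='a] by simp
  then obtain v w where vw: "v \<in> vertices K" "w \<in> vertices K" "v \<noteq> w"
    using card_le_Suc0_iff_eq[OF sv(2)] by (metis One_nat_def not_less)
  have "height K v \<le> dist v w"
    unfolding height_def using vw by (intro infdist_le hull_inc) auto
  moreover have "dist v w \<le> mesh_size T"
    using vw vertices_subset by (intro dist_le_mesh_size[OF K]) blast+
  ultimately show ?thesis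
    using mesh_min_height_le[OF K] min_height_le[OF mesh_simplex[OF mesh K] vw(1)] by linarith
qed

context
  fixes H :: real
  assumes H: "0 < H" "sqrt (real DIM('a)) * H \<le> mesh_min_height T / (real DIM('a) + 1)"
begin

lemma stencil_radius:
  assumes "K \<in> T"
  shows "sqrt (real DIM('a)) * H \<le> min_height K / (real DIM('a) + 1)"
  using H(2) mesh_min_height_le[OF assms] by (meson divide_right_mono of_nat_0_le_iff
      add_nonneg_nonneg zero_le_one order_trans)

lemma stencil_subset_element:
  assumes K: "K \<in> T"
  shows "stencil H (barycentre K) \<subseteq> K"
proof
  fix y assume y: "y \<in> stencil H (barycentre K)"
  have "norm (y - barycentre K) \<le> sqrt (real DIM('a)) * H"
    by (rule norm_le_coordinatewise) (use stencil_coordinate_bounds[OF H(1) y] in force)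
  then have "y \<in> cball (barycentre K) (min_height K / (real DIM('a) + 1))"
    using stencil_radius[OF K] by (simp add: dist_norm norm_minus_commute)
  then show "y \<in> K" using cball_barycentre_subset[OF mesh_simplex[OF mesh K]] by blast
qed

text \<open>A grid node may lie on the boundary of an element and belong to many elements.  Still it is
  in the stencil of only one: pushed slightly in the direction \<open>- One\<close> it enters the interior
  of that element.\<close>

lemma stencils_disjoint:
  assumes K: "K \<in> T" and L: "L \<in> T"
    and y: "y \<in> stencil H (barycentre K)" "y \<in> stencil H (barycentre L)"
  shows "K = L"
proof -
  have *: "\<exists>s>0. \<forall>t. 0 < t \<and> t < s \<longrightarrow> y - t *\<^sub>R One \<in> interior M"
    if M: "M \<in> T" and y: "y \<in> stencil H (barycentre M)" for M
  proof -
    let ?r = "min_height M / (real DIM('a) + 1)"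
    have "ball (barycentre M) ?r \<subseteq> interior M"
      using cball_barycentre_subset[OF mesh_simplex[OF mesh M]] ball_subset_cball
      by (intro interior_maximal) (blast, simp)
    then show ?thesis
      using stencil_pushed_into_ball[OF H(1) stencil_radius[OF M] y] by blast
  qed
  obtain s where s: "0 < s" "\<And>t. 0 < t \<and> t < s \<Longrightarrow> y - t *\<^sub>R One \<in> interior K"
    using *[OF K y(1)] by blast
  obtain s' where s': "0 < s'" "\<And>t. 0 < t \<and> t < s' \<Longrightarrow> y - t *\<^sub>R One \<in> interior L"
    using *[OF L y(2)] by blast
  define t where "t = min s s' / 2"
  have "0 < t \<and> t < s" "0 < t \<and> t < s'" using s(1) s'(1) by (auto simp: t_def min_def)
  then show ?thesis using mesh_interior_disjoint[OF mesh K L] s(2) s'(2) by blast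
qed

text \<open>The stencil at the barycentre lies in \<open>K\<close>, where the finite element function is affine, so the
  stencil values bound its gradient and hence its values at the vertices of \<open>K\<close>.\<close>

lemma nodal_value_bound_on_element:
  assumes K: "K \<in> T" and v: "v \<in> vertices K"
  shows "(u v)\<^sup>2 \<le> (1 + 2 * real DIM('a) * mesh_size T / H)\<^sup>2 *
    (\<Sum>y\<in>stencil H (barycentre K). (\<Sum>w\<in>mesh_vertices T. u w * lagrange_basis T w y)\<^sup>2)"
    (is "_ \<le> ?B\<^sup>2 * (\<Sum>y\<in>?S. (?U y)\<^sup>2)")
proof -
  obtain a b where ab: "\<And>x. x \<in> K \<Longrightarrow> ?U x = inner a x + b"
    "\<And>w. w \<in> vertices K \<Longrightarrow> inner a w + b = u w"
    using nodal_function_affine[OF K, of u] by blast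
  \<comment> \<open>The Euclidean norm of the stencil values dominates their maximum.\<close>
  define M where "M = sqrt (\<Sum>y\<in>?S. (?U y)\<^sup>2)"
  have M: "\<bar>inner a y + b\<bar> \<le> M" if y: "y \<in> ?S" for y
  proof -
    have "(?U y)\<^sup>2 \<le> (\<Sum>y\<in>?S. (?U y)\<^sup>2)"
      using y by (intro member_le_sum) (auto simp: finite_stencil)
    then have "sqrt ((?U y)\<^sup>2) \<le> M" unfolding M_def by (rule real_sqrt_le_mono)
    then show ?thesis using ab(1) stencil_subset_element[OF K] y by auto
  qed
  have "dist (grid_floor H (barycentre K)) v \<le> mesh_size T"
    using stencil_subset_element[OF K] v vertices_subset[of K]
    by (intro dist_le_mesh_size[OF K]) (auto simp: stencil_def)
  then have "\<bar>u v\<bar> \<le> M * ?B"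
    using affine_fun_bound_from_stencil[OF H(1) M] ab(2)[OF v] by metis
  then have "(u v)\<^sup>2 \<le> (M * ?B)\<^sup>2"
    by (metis abs_ge_zero power2_abs power_mono)
  also have "\<dots> = ?B\<^sup>2 * (\<Sum>y\<in>?S. (?U y)\<^sup>2)"
    unfolding power_mult_distrib M_def by (simp add: sum_nonneg)
  finally show ?thesis .
qed

text \<open>Every vertex belongs to some element, so the squared nodal values are at most their sum over all
  elements and their vertices.  There each stencil is used \<open>d + 1\<close> times, once per vertex, and by
  disjointness of the stencils the sum over all of them is part of the sum over the grid.\<close>

lemma nodal_values_bound:
  assumes G: "finite G" "\<And>K. K \<in> T \<Longrightarrow> stencil H (barycentre K) \<subseteq> G"
  shows "(\<Sum>v\<in>mesh_vertices T. (u v)\<^sup>2) \<le>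
    (real DIM('a) + 1) * (1 + 2 * real DIM('a) * mesh_size T / H)\<^sup>2 *
    (\<Sum>y\<in>G. (\<Sum>w\<in>mesh_vertices T. u w * lagrange_basis T w y)\<^sup>2)"
    (is "_ \<le> ?d * ?B\<^sup>2 * (\<Sum>y\<in>G. (?U y)\<^sup>2)")
proof -
  let ?S = "\<lambda>K. stencil H (barycentre K)"
  note finT = mesh_finite[OF mesh]
  note sv = simplex_vertices[OF mesh_simplex[OF mesh]]
  have "(\<Sum>v\<in>mesh_vertices T. (u v)\<^sup>2) \<le> (\<Sum>K\<in>T. \<Sum>v\<in>vertices K. (u v)\<^sup>2)"
    unfolding mesh_vertices_def using finT sv(2) by (intro sum_UNION_le) auto
  also have "\<dots> \<le> (\<Sum>K\<in>T. \<Sum>v\<in>vertices K. ?B\<^sup>2 * (\<Sum>y\<in>?S K. (?U y)\<^sup>2))"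
    by (intro sum_mono nodal_value_bound_on_element)
  also have "\<dots> = ?d * ?B\<^sup>2 * (\<Sum>K\<in>T. \<Sum>y\<in>?S K. (?U y)\<^sup>2)"
    by (simp add: sv(3) sum_distrib_left mult.assoc add.commute)
  also have "(\<Sum>K\<in>T. \<Sum>y\<in>?S K. (?U y)\<^sup>2) = (\<Sum>y\<in>(\<Union>K\<in>T. ?S K). (?U y)\<^sup>2)"
    using finT finite_stencil stencils_disjoint by (intro sum.UNION_disjoint[symmetric]) blast+
  also have "?d * ?B\<^sup>2 * \<dots> \<le> ?d * ?B\<^sup>2 * (\<Sum>y\<in>G. (?U y)\<^sup>2)"
    using G by (intro mult_left_mono sum_mono2) auto
  finally show ?thesis .
qed

end

end

section \<open>Symmetric matrices and full column rank\<close>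

lemma scalar_prod_self: "scalar_prod v v = (\<Sum>i<dim_vec v. (vec_index v i)\<^sup>2)"
  for v :: "'a::comm_semiring_1 Matrix.vec"
  by (simp add: scalar_prod_def power2_eq_square lessThan_atLeast0)

lemma scalar_prod_self_pos:
  fixes v :: "real Matrix.vec"
  assumes "v \<in> carrier_vec n" "v \<noteq> 0\<^sub>v n"
  shows "0 < scalar_prod v v"
proof -
  obtain i where "i < n" "vec_index v i \<noteq> 0"
    using assms by (metis carrier_vecD eq_vecI index_zero_vec)
  then have "0 < (\<Sum>i<dim_vec v. (vec_index v i)\<^sup>2)"
    using assms(1) by (intro sum_pos2[of _ i]) auto
  then show ?thesis by (simp add: scalar_prod_self)
qed

lemma symmetric_mat_scalar_prod:
  fixes A :: "real mat"
  assumes A: "A \<in> carrier_mat n n" "transpose_mat A = A"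
    and x: "x \<in> carrier_vec n" and y: "y \<in> carrier_vec n"
  shows "scalar_prod (A *\<^sub>v x) y = scalar_prod x (A *\<^sub>v y)"
  using transpose_vec_mult_scalar[of A n n y x] A x y
  by (metis comm_scalar_prod mult_mat_vec_carrier)

text \<open>A complex eigenvector \<open>x + i y\<close> with eigenvalue \<open>\<alpha> + i \<beta>\<close> exists by the fundamental theorem of
  algebra.  Comparing the scalar product of \<open>A x\<close> and \<open>y\<close> with that of \<open>x\<close> and \<open>A y\<close> gives
  \<open>\<beta> (x \<cdot> x + y \<cdot> y) = 0\<close>, so \<open>\<beta> = 0\<close> and one of \<open>x\<close>, \<open>y\<close> is a real eigenvector.\<close>

lemma real_symmetric_spectrum_nonempty:
  fixes A :: "real mat"
  assumes A: "A \<in> carrier_mat n n" "transpose_mat A = A" and n: "0 < n"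
  shows "spectrum A \<noteq> {}"
proof -
  define B where "B = map_mat complex_of_real A"
  have B: "B \<in> carrier_mat n n" using A by (simp add: B_def)
  obtain k where "eigenvalue B k"
    using spectrum_non_empty[OF B n] by (auto simp: spectrum_def)
  then obtain v where v: "v \<in> carrier_vec n" "v \<noteq> 0\<^sub>v n" "B *\<^sub>v v = k \<cdot>\<^sub>v v"
    using B by (auto simp: eigenvalue_def eigenvector_def)
  define x where "x = map_vec Re v"
  define y where "y = map_vec Im v"
  have x: "x \<in> carrier_vec n" and y: "y \<in> carrier_vec n" using v by (simp_all add: x_def y_def)
  have row: "(\<Sum>j<n. complex_of_real (A $$ (i, j)) * vec_index v j) = k * vec_index v i" if "i < n" for i
  proof -
    have "vec_index (B *\<^sub>v v) i = (\<Sum>j<n. complex_of_real (A $$ (i, j)) * vec_index v j)"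
      using that A v(1) by (simp add: B_def scalar_prod_def lessThan_atLeast0)
    then show ?thesis using v that by simp
  qed
  have Ax: "A *\<^sub>v x = Re k \<cdot>\<^sub>v x - Im k \<cdot>\<^sub>v y"
  proof (rule eq_vecI)
    fix i assume "i < dim_vec (Re k \<cdot>\<^sub>v x - Im k \<cdot>\<^sub>v y)"
    then have i: "i < n" using y by simp
    have "vec_index (A *\<^sub>v x) i = Re (\<Sum>j<n. complex_of_real (A $$ (i, j)) * vec_index v j)"
      using i A v(1) by (simp add: scalar_prod_def lessThan_atLeast0 x_def)
    then show "vec_index (A *\<^sub>v x) i = vec_index (Re k \<cdot>\<^sub>v x - Im k \<cdot>\<^sub>v y) i"
      unfolding row[OF i] using i v(1) by (simp add: x_def y_def)
  qed (use A x y in simp)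
  have Ay: "A *\<^sub>v y = Re k \<cdot>\<^sub>v y + Im k \<cdot>\<^sub>v x"
  proof (rule eq_vecI)
    fix i assume "i < dim_vec (Re k \<cdot>\<^sub>v y + Im k \<cdot>\<^sub>v x)"
    then have i: "i < n" using x by simp
    have "vec_index (A *\<^sub>v y) i = Im (\<Sum>j<n. complex_of_real (A $$ (i, j)) * vec_index v j)"
      using i A v(1) by (simp add: scalar_prod_def lessThan_atLeast0 y_def)
    then show "vec_index (A *\<^sub>v y) i = vec_index (Re k \<cdot>\<^sub>v y + Im k \<cdot>\<^sub>v x) i"
      unfolding row[OF i] using i v(1) by (simp add: x_def y_def)
  qed (use A x y in simp)
  have xy: "x \<noteq> 0\<^sub>v n \<or> y \<noteq> 0\<^sub>v n"
  proof (rule ccontr)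
    assume "\<not> ?thesis"
    then have 0: "x = 0\<^sub>v n" "y = 0\<^sub>v n" by auto
    have "v = 0\<^sub>v n"
    proof (rule eq_vecI)
      fix i assume "i < dim_vec (0\<^sub>v n :: complex Matrix.vec)"
      then have i: "i < n" by simp
      have "Re (vec_index v i) = vec_index x i" "Im (vec_index v i) = vec_index y i"
        using i v(1) by (simp_all add: x_def y_def)
      then show "vec_index v i = vec_index (0\<^sub>v n) i" using 0 i by (simp add: complex_eq_iff)
    qed (use v in simp)
    then show False using v by simp
  qed
  have nonneg: "0 \<le> scalar_prod x x" "0 \<le> scalar_prod y y"
    by (simp_all add: scalar_prod_self sum_nonneg)
  have "scalar_prod (A *\<^sub>v x) y = scalar_prod x (A *\<^sub>v y)"
    by (rule symmetric_mat_scalar_prod[OF A x y])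
  then have "Re k * scalar_prod x y - Im k * scalar_prod y y
      = Re k * scalar_prod x y + Im k * scalar_prod x x"
    unfolding Ax Ay using x y
    by (simp add: minus_scalar_prod_distrib[of _ n] scalar_prod_add_distrib[of _ n])
  then have "Im k * (scalar_prod x x + scalar_prod y y) = 0" by (simp add: algebra_simps)
  moreover have "0 < scalar_prod x x + scalar_prod y y"
    using xy nonneg scalar_prod_self_pos[OF x] scalar_prod_self_pos[OF y] by fastforce
  ultimately have k: "Im k = 0" by simp
  have "A *\<^sub>v x = Re k \<cdot>\<^sub>v x" "A *\<^sub>v y = Re k \<cdot>\<^sub>v y"
    unfolding Ax Ay k using x y by auto
  then have "eigenvalue A (Re k)"
    unfolding eigenvalue_def eigenvector_def using xy x y A(1) by auto
  then show ?thesis by (auto simp: spectrum_def)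
qed

lemma gram_scalar_prod:
  fixes A :: "real mat"
  assumes A: "A \<in> carrier_mat m n" and v: "v \<in> carrier_vec n"
  shows "scalar_prod v ((transpose_mat A * A) *\<^sub>v v) = scalar_prod (A *\<^sub>v v) (A *\<^sub>v v)"
proof -
  have Av: "A *\<^sub>v v \<in> carrier_vec m" using A v by (rule mult_mat_vec_carrier)
  have "(transpose_mat A * A) *\<^sub>v v = transpose_mat A *\<^sub>v (A *\<^sub>v v)"
    using A v by (intro assoc_mult_mat_vec) auto
  then show ?thesis
    using transpose_vec_mult_scalar[OF A v Av] comm_scalar_prod[of v n "transpose_mat A *\<^sub>v (A *\<^sub>v v)"] A v
    by auto
qed

text \<open>The minimum over the spectrum is meaningful because the spectrum of the Gram matrix is finite
  and nonempty; each eigenvalue is a Rayleigh quotient.\<close>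

lemma gram_min_eigenvalue_ge:
  fixes A :: "real mat"
  assumes A: "A \<in> carrier_mat m n" and n: "0 < n"
    and c: "\<And>v. v \<in> carrier_vec n \<Longrightarrow> c * scalar_prod v v \<le> scalar_prod (A *\<^sub>v v) (A *\<^sub>v v)"
  shows "c \<le> min_eigenvalue (transpose_mat A * A)"
proof -
  let ?G = "transpose_mat A * A"
  have G: "?G \<in> carrier_mat n n" using A by auto
  have "transpose_mat ?G = ?G"
    using transpose_mult[of "transpose_mat A" n m A n] A by simp
  then have ne: "spectrum ?G \<noteq> {}" using real_symmetric_spectrum_nonempty[OF G _ n] by blast
  have "c \<le> k" if k: "k \<in> spectrum ?G" for k
  proof -
    obtain v where "eigenvector ?G v k" using k by (auto simp: spectrum_def eigenvalue_def)
    then have v: "v \<in> carrier_vec n" "v \<noteq> 0\<^sub>v n" "?G *\<^sub>v v = k \<cdot>\<^sub>v v"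
      unfolding eigenvector_def carrier_matD(1)[OF G] by blast+
    have "c * scalar_prod v v \<le> scalar_prod v (?G *\<^sub>v v)"
      unfolding gram_scalar_prod[OF A v(1)] by (rule c[OF v(1)])
    also have "\<dots> = k * scalar_prod v v" unfolding v(3) using v(1) by simp
    finally show ?thesis using scalar_prod_self_pos[OF v(1,2)] by simp
  qed
  then show ?thesis
    unfolding min_eigenvalue_def using ne card_finite_spectrum(1)[OF G] by simp
qed

lemma full_column_rank_if_injective:
  fixes A :: "real mat"
  assumes A: "A \<in> carrier_mat m n"
    and inj: "\<And>v. v \<in> carrier_vec n \<Longrightarrow> A *\<^sub>v v = 0\<^sub>v m \<Longrightarrow> v = 0\<^sub>v n"
  shows "full_column_rank A"
proof -
  interpret vec_space "TYPE(real)" m .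
  have dist: "distinct (cols A)"
  proof (subst distinct_conv_nth, intro allI impI notI)
    fix i j assume "i < length (cols A)" "j < length (cols A)" "i \<noteq> j" and eq: "cols A ! i = cols A ! j"
    then have i: "i < n" and j: "j < n" and ij: "i \<noteq> j" using A by auto
    have "A *\<^sub>v (unit_vec n i - unit_vec n j) = A *\<^sub>v unit_vec n i - A *\<^sub>v unit_vec n j"
      using A by (intro mult_minus_distrib_mat_vec) auto
    also have "\<dots> = Matrix.col A i - Matrix.col A j"
      using A i j by (intro eq_vecI) simp_all
    also have "\<dots> = 0\<^sub>v m" using eq i j A by auto
    finally have "unit_vec n i - unit_vec n j = (0\<^sub>v n :: real Matrix.vec)"
      by (intro inj) auto
    then have "vec_index (unit_vec n i - unit_vec n j :: real Matrix.vec) i = 0" using i by simp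
    then show False using i j ij by simp
  qed
  have "lin_indpt (set (cols A))"
    using lin_depE[OF A _ dist] inj by metis
  then have "rank A = n" by (rule lin_indpt_full_rank[OF A dist])
  then show ?thesis using A by (simp add: full_column_rank_def)
qed

lemma invertible_mat_diag:
  fixes f :: "nat \<Rightarrow> real"
  assumes "\<And>i. i < n \<Longrightarrow> f i \<noteq> 0"
  shows "invertible_mat (mat_diag n f)"
proof -
  have "mat_diag n f * mat_diag n (\<lambda>i. 1 / f i) = 1\<^sub>m n"
    "mat_diag n (\<lambda>i. 1 / f i) * mat_diag n f = 1\<^sub>m n"
    unfolding mat_diag_diag by (rule eq_matI; use assms in \<open>simp add: mat_diag_def\<close>)+
  then show ?thesis
    unfolding invertible_mat_def inverts_mat_def
    by (metis carrier_matD mat_diag_dim square_mat.simps)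
qed

section \<open>Column sums and the smallest eigenvalue\<close>

text \<open>The factor \<open>d + 1\<close> counts the vertices of an element.  The squared factor is the ratio of a
  vertex value to the stencil values: the stencil spacing is at least
  \<open>a / (2 (d + 1) sqrt d)\<close>, where \<open>a\<close> is the smallest height, so the gradient bound contributes
  \<open>2 d (2 (d + 1) sqrt d)\<close> times the mesh size over \<open>a\<close>.\<close>

definition stability_constant :: "'a::euclidean_space itself \<Rightarrow> real" where
  "stability_constant _ = (let d = real DIM('a) in
     1 / ((d + 1) * (1 + 4 * d * (d + 1) * sqrt d)\<^sup>2))"

lemma stability_constant_pos: "0 < stability_constant TYPE('a::euclidean_space)"
  unfolding stability_constant_def Let_def
  by (intro divide_pos_pos mult_pos_pos zero_less_power add_pos_nonneg mult_nonneg_nonneg) auto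

context
  fixes T :: "'a::euclidean_space set set" and Omega :: "'a set" and R :: real and N :: nat
  assumes mesh: "simplicial_mesh Omega T"
    and grid: "0 < R" "0 < N" "\<Union>T \<subseteq> box (- R *\<^sub>R One) (R *\<^sub>R One)"
    and fine: "fd_spacing R N \<le> mesh_min_height T / ((real DIM('a) + 1) * sqrt (real DIM('a)))"
    and grid_finite: "finite (fd_grid R N :: 'a set)"
begin

lemma fd_spacing_pos: "0 < fd_spacing R N"
  using grid by (simp add: fd_spacing_def)

lemma mesh_min_height_pos: "0 < mesh_min_height T"
proof -
  have "0 < mesh_min_height T / ((real DIM('a) + 1) * sqrt (real DIM('a)))"
    using fine fd_spacing_pos by linarith
  moreover have "0 < (real DIM('a) + 1) * sqrt (real DIM('a))"
    using DIM_positive[where 'a='a] by simp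
  ultimately show ?thesis by (auto simp: zero_less_divide_iff)
qed

lemma sqrt_dim_mult_le_iff:
  "sqrt (real DIM('a)) * H \<le> a / (real DIM('a) + 1)
    \<longleftrightarrow> H \<le> a / ((real DIM('a) + 1) * sqrt (real DIM('a)))"
  using DIM_positive[where 'a='a] by (simp add: field_simps add_pos_nonneg)

text \<open>Rounding the barycentre to the grid in the direction of the gradient of the basis function
  stays within the element and keeps the value \<open>1 / (d + 1)\<close> of the barycentre.\<close>

lemma lagrange_basis_grid_value:
  assumes v: "v \<in> mesh_vertices T"
  obtains y where "y \<in> fd_grid R N" "1 / (real DIM('a) + 1) \<le> lagrange_basis T v y"
proof -
  obtain K where K: "K \<in> T" "v \<in> vertices K" using v by (auto simp: mesh_vertices_def)
  note sK = mesh_simplex[OF mesh K(1)]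
  obtain a b where ab: "\<And>x. x \<in> K \<Longrightarrow> lagrange_basis T v x = inner a x + b"
    "\<And>w. w \<in> vertices K \<Longrightarrow> inner a w + b = (if w = v then 1 else 0)"
    using lagrange_basis_affine[OF mesh K(1)] by blast
  have "(\<Sum>w\<in>vertices K. inner a w + b) = (\<Sum>w\<in>vertices K. if w = v then 1 else 0)"
    by (rule sum.cong) (simp_all add: ab(2))
  then have c: "inner a (barycentre K) + b = 1 / (real DIM('a) + 1)"
    unfolding affine_fun_barycentre[OF sK] using K(2) simplex_vertices(2)[OF sK] by simp
  obtain y where y: "\<And>i. i \<in> Basis \<Longrightarrow> \<exists>j::int. inner y i = fd_spacing R N * of_int j"
    "norm (y - barycentre K) \<le> sqrt (real DIM('a)) * fd_spacing R N"
    "inner a (barycentre K) \<le> inner a y"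
    using affine_fun_grid_rounding[OF fd_spacing_pos] by blast
  have "sqrt (real DIM('a)) * fd_spacing R N \<le> min_height K / (real DIM('a) + 1)"
    using stencil_radius[OF mesh fd_spacing_pos _ K(1)] fine sqrt_dim_mult_le_iff by blast
  then have "y \<in> cball (barycentre K) (min_height K / (real DIM('a) + 1))"
    using y(2) by (simp add: dist_norm norm_minus_commute)
  then have yK: "y \<in> K" using cball_barycentre_subset[OF sK] by blast
  then have "y \<in> fd_grid R N"
    using grid K(1) y(1) by (intro fd_grid_memI) blast+
  moreover have "1 / (real DIM('a) + 1) \<le> lagrange_basis T v y" using ab(1)[OF yK] y(3) c by linarith
  ultimately show thesis using that by blast
qed

lemma column_sum_lower_bound:
  assumes v: "v \<in> mesh_vertices T"
  shows "1 / (real DIM('a) + 1) \<le> (\<Sum>y\<in>fd_grid R N. lagrange_basis T v y)"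
proof -
  obtain y where y: "y \<in> fd_grid R N" "1 / (real DIM('a) + 1) \<le> lagrange_basis T v y"
    using lagrange_basis_grid_value[OF v] by blast
  have "lagrange_basis T v y \<le> (\<Sum>y\<in>fd_grid R N. lagrange_basis T v y)"
    using y(1) grid_finite lagrange_basis_bounds[OF mesh] by (intro member_le_sum) auto
  then show ?thesis using y(2) by linarith
qed

text \<open>The basis function is at most \<open>1\<close> and vanishes off the patch, so the column sum is at most the
  number of grid nodes in the patch, counted element by element.\<close>

lemma column_sum_upper_bound:
  assumes v: "v \<in> mesh_vertices T"
  shows "(\<Sum>y\<in>fd_grid R N. lagrange_basis T v y)
    \<le> real (max_patch_card T) * real (max_grid_card T R N)"
proof -
  let ?G = "fd_grid R N :: 'a set"
  note finT = mesh_finite[OF mesh]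
  have finP: "finite (patch T v)" using finT by (simp add: patch_def)
  have "(\<Sum>y\<in>?G. lagrange_basis T v y) = (\<Sum>y\<in>(\<Union>K\<in>patch T v. ?G \<inter> K). lagrange_basis T v y)"
    using grid_finite lagrange_basis_support[OF mesh, of v]
    by (intro sum.mono_neutral_right) blast+
  also have "\<dots> \<le> (\<Sum>K\<in>patch T v. \<Sum>y\<in>?G \<inter> K. lagrange_basis T v y)"
    using finP grid_finite lagrange_basis_bounds[OF mesh] by (intro sum_UNION_le) auto
  also have "\<dots> \<le> (\<Sum>K\<in>patch T v. real (max_grid_card T R N))"
  proof (rule sum_mono)
    fix K assume "K \<in> patch T v"
    then have "card (?G \<inter> K) \<le> max_grid_card T R N"
      unfolding max_grid_card_def using finT by (intro Max_ge) (auto simp: patch_def)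
    moreover have "(\<Sum>y\<in>?G \<inter> K. lagrange_basis T v y) \<le> (\<Sum>y\<in>?G \<inter> K. 1)"
      by (intro sum_mono lagrange_basis_bounds[OF mesh])
    ultimately show "(\<Sum>y\<in>?G \<inter> K. lagrange_basis T v y) \<le> real (max_grid_card T R N)" by simp
  qed
  also have "\<dots> = real (card (patch T v)) * real (max_grid_card T R N)" by simp
  also have "\<dots> \<le> real (max_patch_card T) * real (max_grid_card T R N)"
  proof -
    have "card (patch T v) \<le> max_patch_card T"
      unfolding max_patch_card_def using finite_mesh_vertices[OF mesh] v by (intro Max_ge) auto
    then show ?thesis by (intro mult_right_mono) auto
  qed
  finally show ?thesis .
qed

lemma height_ratio:
  assumes "T \<noteq> {}"
  shows "0 < mesh_min_height T / mesh_size T" "mesh_min_height T / mesh_size T \<le> 1"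
proof -
  have "mesh_min_height T \<le> mesh_size T" using assms mesh_min_height_le_mesh_size[OF mesh] by blast
  then show "0 < mesh_min_height T / mesh_size T" "mesh_min_height T / mesh_size T \<le> 1"
    using mesh_min_height_pos by auto
qed

text \<open>The grid spacing may be arbitrarily small compared with the heights, and difference quotients
  over a single grid step would then lose a factor depending on the grid.  The stencil therefore
  uses the coarse spacing \<open>H\<close>, a multiple of the grid spacing comparable to the smallest height.
  This gives the square of the ratio of height to mesh size; the power \<open>2 d\<close> of the
  ratio is no larger, as the ratio is at most \<open>1\<close>.\<close>

lemma nodal_values_stability:
  assumes "T \<noteq> {}"
  shows "stability_constant TYPE('a) * (mesh_min_height T / mesh_size T) ^ (2 * DIM('a)) *
      (\<Sum>v\<in>mesh_vertices T. (u v)\<^sup>2)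
    \<le> (\<Sum>y\<in>fd_grid R N. (\<Sum>w\<in>mesh_vertices T. u w * lagrange_basis T w y)\<^sup>2)"
    (is "_ \<le> ?S")
proof -
  define d where "d = real DIM('a)"
  define q where "q = mesh_min_height T / mesh_size T"
  define \<beta> where "\<beta> = 1 + 4 * d * (d + 1) * sqrt d"
  have d: "1 \<le> d" unfolding d_def using DIM_positive[where 'a='a] by linarith
  have q: "0 < q" "q \<le> 1" using height_ratio[OF assms] by (simp_all add: q_def)
  have \<beta>: "0 < \<beta>" using d by (simp add: \<beta>_def add_pos_nonneg)
  obtain m :: nat where m: "0 < real m * fd_spacing R N"
    "real m * fd_spacing R N \<le> mesh_min_height T / ((d + 1) * sqrt d)"
    "mesh_min_height T / ((d + 1) * sqrt d) \<le> 2 * (real m * fd_spacing R N)"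
    using coarse_multiple[OF fd_spacing_pos fine] unfolding d_def by blast
  define H where "H = real m * fd_spacing R N"
  have H: "0 < H" "sqrt (real DIM('a)) * H \<le> mesh_min_height T / (real DIM('a) + 1)"
    using m(1,2) unfolding sqrt_dim_mult_le_iff H_def d_def by simp_all
  have sub: "stencil H (barycentre K) \<subseteq> fd_grid R N" if K: "K \<in> T" for K
  proof
    fix y assume y: "y \<in> stencil H (barycentre K)"
    show "y \<in> fd_grid R N"
    proof (rule fd_grid_memI[OF grid(1,2)])
      show "y \<in> box (- R *\<^sub>R One) (R *\<^sub>R One)"
        using stencil_subset_element[OF mesh H K] y K grid(3) by blast
      fix i :: 'a assume i: "i \<in> Basis"
      obtain j :: int where "inner y i = H * of_int j" using stencil_inner[OF y i] by blast
      then have "inner y i = fd_spacing R N * of_int (int m * j)" by (simp add: H_def)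
      then show "\<exists>j::int. inner y i = fd_spacing R N * of_int j" by blast
    qed
  qed
  have bound: "(\<Sum>v\<in>mesh_vertices T. (u v)\<^sup>2) \<le> (d + 1) * (1 + 2 * d * mesh_size T / H)\<^sup>2 * ?S"
    unfolding d_def by (rule nodal_values_bound[OF mesh H grid_finite sub])
  have h: "0 < mesh_size T" "mesh_min_height T = q * mesh_size T"
    using q mesh_min_height_pos by (auto simp: q_def zero_less_divide_iff)
  have "q * mesh_size T \<le> 2 * H * ((d + 1) * sqrt d)"
    using m(3) d unfolding H_def[symmetric] h(2) by (subst (asm) pos_divide_le_eq) auto
  then have "mesh_size T / H \<le> 2 * (d + 1) * sqrt d / q"
    using q H(1) by (simp add: field_simps)
  then have "2 * d * (mesh_size T / H) \<le> 2 * d * (2 * (d + 1) * sqrt d / q)"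
    using d by (intro mult_left_mono) auto
  moreover have "1 \<le> 1 / q" using q by simp
  moreover have "2 * d * (2 * (d + 1) * sqrt d / q) = 4 * d * (d + 1) * sqrt d / q"
    by (simp add: algebra_simps)
  moreover have "\<beta> / q = 1 / q + 4 * d * (d + 1) * sqrt d / q"
    by (simp add: \<beta>_def add_divide_distrib)
  ultimately have "1 + 2 * d * mesh_size T / H \<le> \<beta> / q"
    by (simp only: times_divide_eq_right)
  moreover have "0 \<le> 1 + 2 * d * mesh_size T / H" using d h(1) H(1) by simp
  ultimately have "(1 + 2 * d * mesh_size T / H)\<^sup>2 \<le> (\<beta> / q)\<^sup>2" by (intro power_mono)
  then have "(d + 1) * (1 + 2 * d * mesh_size T / H)\<^sup>2 * ?S \<le> (d + 1) * (\<beta> / q)\<^sup>2 * ?S"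
    using d by (intro mult_right_mono mult_left_mono) (auto simp: sum_nonneg)
  then have main: "(\<Sum>v\<in>mesh_vertices T. (u v)\<^sup>2) \<le> (d + 1) * (\<beta> / q)\<^sup>2 * ?S" using bound by linarith
  have const: "stability_constant TYPE('a) = 1 / ((d + 1) * \<beta>\<^sup>2)"
    by (simp add: stability_constant_def Let_def d_def \<beta>_def)
  have "q ^ (2 * DIM('a)) \<le> q\<^sup>2"
    using q DIM_positive[where 'a='a] by (intro power_decreasing) auto
  then have "stability_constant TYPE('a) * q ^ (2 * DIM('a)) * (\<Sum>v\<in>mesh_vertices T. (u v)\<^sup>2)
      \<le> stability_constant TYPE('a) * q\<^sup>2 * ((d + 1) * (\<beta> / q)\<^sup>2 * ?S)"
    using main stability_constant_pos[where 'a='a] q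
    by (intro mult_mono mult_left_mono) (auto simp: sum_nonneg)
  also have "\<dots> = ?S"
  proof -
    have "d + 1 \<noteq> 0" using d by simp
    then show ?thesis unfolding const using q \<beta> by (simp add: power_divide)
  qed
  finally show ?thesis unfolding q_def .
qed

end

section \<open>The transfer matrix\<close>

lemma sum_nth_distinct:
  "distinct xs \<Longrightarrow> (\<Sum>i<length xs. f (xs ! i)) = sum f (set xs)"
  by (rule sum.reindex_bij_betw[OF bij_betw_nth]) auto

lemma col_sum_transfer_mat:
  assumes "distinct gs" "j < length vs"
  shows "col_sum (transfer_mat T vs gs) j = (\<Sum>y\<in>set gs. lagrange_basis T (vs ! j) y)"
  using assms sum_nth_distinct[OF assms(1), of "lagrange_basis T (vs ! j)"]
  by (simp add: col_sum_def transfer_mat_def)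

lemma transfer_mat_norm_bound:
  assumes dist: "distinct vs" "distinct gs"
    and c: "\<And>u. c * (\<Sum>v\<in>set vs. (u v)\<^sup>2)
      \<le> (\<Sum>y\<in>set gs. (\<Sum>w\<in>set vs. u w * lagrange_basis T w y)\<^sup>2)"
    and x: "x \<in> carrier_vec (length vs)"
  shows "c * scalar_prod x x
    \<le> scalar_prod (transfer_mat T vs gs *\<^sub>v x) (transfer_mat T vs gs *\<^sub>v x)"
proof -
  let ?A = "transfer_mat T vs gs"
  \<comment> \<open>The vector \<open>x\<close> read as a function on the mesh vertices, via the position of a vertex in \<open>vs\<close>.\<close>
  define u where "u v = vec_index x (inv_into {..<length vs} ((!) vs) v)" for v
  have u: "u (vs ! j) = vec_index x j" if "j < length vs" for j
    unfolding u_def using that dist(1) by (subst inv_into_f_f) (auto simp: inj_on_nth)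
  have "scalar_prod x x = (\<Sum>j<length vs. (u (vs ! j))\<^sup>2)"
    using x by (simp add: scalar_prod_self u)
  then have 1: "scalar_prod x x = (\<Sum>v\<in>set vs. (u v)\<^sup>2)"
    using sum_nth_distinct[OF dist(1), of "\<lambda>v. (u v)\<^sup>2"] by simp
  have "vec_index (?A *\<^sub>v x) k = (\<Sum>w\<in>set vs. u w * lagrange_basis T w (gs ! k))"
    if k: "k < length gs" for k
  proof -
    have "vec_index (?A *\<^sub>v x) k
        = (\<Sum>j<length vs. u (vs ! j) * lagrange_basis T (vs ! j) (gs ! k))"
      using k x by (simp add: transfer_mat_def scalar_prod_def lessThan_atLeast0 u mult.commute)
    then show ?thesis
      using sum_nth_distinct[OF dist(1), of "\<lambda>w. u w * lagrange_basis T w (gs ! k)"] by simp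
  qed
  then have "scalar_prod (?A *\<^sub>v x) (?A *\<^sub>v x)
      = (\<Sum>k<length gs. (\<Sum>w\<in>set vs. u w * lagrange_basis T w (gs ! k))\<^sup>2)"
    by (simp add: scalar_prod_self transfer_mat_def)
  also have "\<dots> = (\<Sum>y\<in>set gs. (\<Sum>w\<in>set vs. u w * lagrange_basis T w y)\<^sup>2)"
    by (rule sum_nth_distinct[OF dist(2)])
  finally show ?thesis using c[of u] 1 by simp
qed

theorem theorem3p2:
  shows "\<exists>C::real. C > 0 \<and>
    (\<forall>(Omega :: 'a::euclidean_space set) T R N vs gs.
       open Omega \<and> connected Omega \<and> Omega \<noteq> {} \<and> bounded Omega \<and>
       simplicial_mesh Omega T \<and>
       0 < R \<and> 0 < N \<and>
       Omega \<union> \<Union>T \<subseteq> box (- R *\<^sub>R One) (R *\<^sub>R One) \<and>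
       distinct vs \<and> set vs = mesh_vertices T \<and>
       distinct gs \<and> set gs = fd_grid R N \<and>
       fd_spacing R N \<le> mesh_min_height T / ((real DIM('a) + 1) * sqrt (real DIM('a)))
       \<longrightarrow>
       (let A = transfer_mat T vs gs in
         (\<forall>j<length vs.
            1 / ((real DIM('a) + 1) * sqrt (real DIM('a))) * (mesh_min_height T / mesh_size T)
              \<le> col_sum A j \<and>
            col_sum A j \<le> real (max_patch_card T) * real (max_grid_card T R N)) \<and>
         invertible_mat (mat_diag (length vs) (col_sum A)) \<and>
         min_eigenvalue (transpose_mat A * A)
           \<ge> C * (mesh_min_height T / mesh_size T) ^ (2 * DIM('a)) \<and>
         full_column_rank A))"
proof (rule exI[of _ "stability_constant TYPE('a)"], intro conjI allI impI)
  show "0 < stability_constant TYPE('a)" by (rule stability_constant_pos)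
  fix Omega :: "'a set" and T :: "'a set set" and R :: real and N :: nat and vs gs :: "'a list"
  assume "open Omega \<and> connected Omega \<and> Omega \<noteq> {} \<and> bounded Omega \<and>
       simplicial_mesh Omega T \<and>
       0 < R \<and> 0 < N \<and>
       Omega \<union> \<Union>T \<subseteq> box (- R *\<^sub>R One) (R *\<^sub>R One) \<and>
       distinct vs \<and> set vs = mesh_vertices T \<and>
       distinct gs \<and> set gs = fd_grid R N \<and>
       fd_spacing R N \<le> mesh_min_height T / ((real DIM('a) + 1) * sqrt (real DIM('a)))"
  then have ne: "Omega \<noteq> {}" and mesh: "simplicial_mesh Omega T"
    and grid: "0 < R" "0 < N" "\<Union>T \<subseteq> box (- R *\<^sub>R One) (R *\<^sub>R One)"
    and vs: "distinct vs" "set vs = mesh_vertices T"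
    and gs: "distinct gs" "set gs = fd_grid R N"
    and fine: "fd_spacing R N \<le> mesh_min_height T / ((real DIM('a) + 1) * sqrt (real DIM('a)))"
    by auto
  have fin: "finite (fd_grid R N :: 'a set)" using gs(2) by (metis finite_set)
  note ctx = mesh grid fine fin
  define q where "q = mesh_min_height T / mesh_size T"
  define A where "A = transfer_mat T vs gs"
  have A: "A \<in> carrier_mat (length gs) (length vs)" by (simp add: A_def transfer_mat_def)
  have Tne: "T \<noteq> {}" using ne mesh_Union[OF mesh] by (metis Sup_empty closure_eq_empty)
  then obtain K where K: "K \<in> T" by auto
  have "vertices K \<noteq> {}" using simplex_vertices(3)[OF mesh_simplex[OF mesh K]] by auto
  then have "mesh_vertices T \<noteq> {}" using K by (auto simp: mesh_vertices_def)
  then have vs0: "0 < length vs" using vs(2) by auto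
  have q: "0 < q" "q \<le> 1" using height_ratio[OF ctx Tne] by (simp_all add: q_def)
  have d: "1 \<le> real DIM('a)" using DIM_positive[where 'a='a] by linarith
  have sums: "1 / (real DIM('a) + 1) \<le> col_sum A j"
    "col_sum A j \<le> real (max_patch_card T) * real (max_grid_card T R N)" if "j < length vs" for j
  proof -
    have v: "vs ! j \<in> mesh_vertices T" using nth_mem[OF that] unfolding vs(2) .
    have eq: "col_sum A j = (\<Sum>y\<in>fd_grid R N. lagrange_basis T (vs ! j) y)"
      unfolding A_def col_sum_transfer_mat[OF gs(1) that] gs(2) ..
    show "1 / (real DIM('a) + 1) \<le> col_sum A j"
      unfolding eq by (rule column_sum_lower_bound[OF ctx v])
    show "col_sum A j \<le> real (max_patch_card T) * real (max_grid_card T R N)"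
      unfolding eq by (rule column_sum_upper_bound[OF ctx v])
  qed
  have "1 / ((real DIM('a) + 1) * sqrt (real DIM('a))) * q \<le> 1 / (real DIM('a) + 1)"
  proof -
    have "1 \<le> sqrt (real DIM('a))" by (rule real_sqrt_ge_one[OF d])
    then have "q \<le> sqrt (real DIM('a))" using q(2) by linarith
    then have "q / sqrt (real DIM('a)) \<le> 1" by (simp add: divide_le_eq)
    then have "1 / (real DIM('a) + 1) * (q / sqrt (real DIM('a))) \<le> 1 / (real DIM('a) + 1) * 1"
      by (intro mult_left_mono) auto
    then show ?thesis by simp
  qed
  then have i: "\<forall>j<length vs. 1 / ((real DIM('a) + 1) * sqrt (real DIM('a))) * q \<le> col_sum A j \<and>
      col_sum A j \<le> real (max_patch_card T) * real (max_grid_card T R N)"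
    using sums by (meson order_trans)
  have "0 < 1 / (real DIM('a) + 1)" by simp
  then have inv: "invertible_mat (mat_diag (length vs) (col_sum A))"
    using sums(1) by (intro invertible_mat_diag) force
  define c where "c = stability_constant TYPE('a) * q ^ (2 * DIM('a))"
  have "c * (\<Sum>v\<in>set vs. (u v)\<^sup>2) \<le> (\<Sum>y\<in>set gs. (\<Sum>w\<in>set vs. u w * lagrange_basis T w y)\<^sup>2)" for u
    unfolding c_def q_def vs(2) gs(2) by (rule nodal_values_stability[OF ctx Tne])
  then have bound: "c * scalar_prod x x \<le> scalar_prod (A *\<^sub>v x) (A *\<^sub>v x)"
    if "x \<in> carrier_vec (length vs)" for x
    unfolding A_def by (intro transfer_mat_norm_bound vs(1) gs(1) that)
  have "0 < c" unfolding c_def using q stability_constant_pos[where 'a='a] by simp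
  have "full_column_rank A"
  proof (rule full_column_rank_if_injective[OF A])
    fix x assume x: "x \<in> carrier_vec (length vs)" "A *\<^sub>v x = 0\<^sub>v (length gs)"
    show "x = 0\<^sub>v (length vs)"
    proof (rule ccontr)
      assume "x \<noteq> 0\<^sub>v (length vs)"
      then have "0 < c * scalar_prod x x" using \<open>0 < c\<close> scalar_prod_self_pos[OF x(1)] by simp
      then show False using bound[OF x(1)] x(2) by simp
    qed
  qed
  then show "let A = transfer_mat T vs gs in
         (\<forall>j<length vs.
            1 / ((real DIM('a) + 1) * sqrt (real DIM('a))) * (mesh_min_height T / mesh_size T)
              \<le> col_sum A j \<and>
            col_sum A j \<le> real (max_patch_card T) * real (max_grid_card T R N)) \<and>
         invertible_mat (mat_diag (length vs) (col_sum A)) \<and>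
         min_eigenvalue (transpose_mat A * A)
           \<ge> stability_constant TYPE('a) * (mesh_min_height T / mesh_size T) ^ (2 * DIM('a)) \<and>
         full_column_rank A"
    unfolding Let_def A_def[symmetric] q_def[symmetric] c_def[symmetric]
    using i inv gram_min_eigenvalue_ge[OF A vs0 bound] by blast
qed

end
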